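(* There is a positive constant $c$ such that, for every positive integer $n$, there is a $4$-regular graph $G$ of order at least $n$ that can be embedded on the torus, and there are two dominating sets $D$ and $D'$ of $G$, both of order $n(G)/5$, such that $$\partial\gamma_G(D,D')\geq c\sqrt{n(G)}.$$
   Context: All graphs are finite, simple and undirected; $n(G)$ denotes the number of vertices of $G$. A set $D\subseteq V(G)$ is a dominating set in $G$ if every vertex of $G$ belongs to $D$ or has a neighbor in $D$. Two dominating sets $D,D'$ are adjacent if $|D\setminus D'|+|D'\setminus D|=1$. For a positive integer $k$, $D$ $k$-transforms to $D'$ if there is a sequence $D_0,\ldots,D_\ell$ of dominating sets in $G$ with $D_0=D$, $D_\ell=D'$, $|D_i|\leq k$ for all $i\in\{0,\ldots,\ell\}$, and $D_{i-1}$ adjacent to $D_i$ for all $i\in\{1,\ldots,\ell\}$. For dominating sets $D,D'$ of $G$, $\partial\gamma_G(D,D')=k-\max\{|D|,|D'|\}$, where $k$ is the smallest positive integer such that $D$ $k$-transforms to $D'$. *)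

theory Defs
  imports "HOL-Analysis.Analysis"
begin

text \<open>A graph is given by its vertex set \<open>V\<close> and its edge set \<open>E\<close>,
  an edge being the two-element set of its ends.\<close>

definition finite_simple_graph :: "'a set \<Rightarrow> 'a set set \<Rightarrow> bool" where
  "finite_simple_graph V E \<longleftrightarrow> finite V \<and> (\<forall>e\<in>E. e \<subseteq> V \<and> card e = 2)"

definition neighbors :: "'a set set \<Rightarrow> 'a \<Rightarrow> 'a set" where
  "neighbors E v = {u. {u, v} \<in> E}"

definition regular :: "nat \<Rightarrow> 'a set \<Rightarrow> 'a set set \<Rightarrow> bool" where
  "regular d V E \<longleftrightarrow> (\<forall>v\<in>V. card (neighbors E v) = d)"

definition dominating :: "'a set \<Rightarrow> 'a set set \<Rightarrow> 'a set \<Rightarrow> bool" where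
  "dominating V E D \<longleftrightarrow> D \<subseteq> V \<and> (\<forall>v\<in>V. v \<in> D \<or> neighbors E v \<inter> D \<noteq> {})"

definition adjacent_sets :: "'a set \<Rightarrow> 'a set \<Rightarrow> bool" where
  "adjacent_sets D D' \<longleftrightarrow> card (D - D') + card (D' - D) = 1"

definition transforms ::
  "'a set \<Rightarrow> 'a set set \<Rightarrow> nat \<Rightarrow> 'a set \<Rightarrow> 'a set \<Rightarrow> bool" where
  "transforms V E k D D' \<longleftrightarrow>
     (\<exists>(l::nat) S :: nat \<Rightarrow> 'a set.
        S 0 = D \<and> S l = D' \<and>
        (\<forall>i\<in>{0..l}. dominating V E (S i) \<and> card (S i) \<le> k) \<and>
        (\<forall>i\<in>{1..l}. adjacent_sets (S (i - 1)) (S i)))"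

text \<open>For dominating sets of a nonempty finite graph the minimum exists: adding the
  missing vertices one by one and then deleting those outside \<open>D'\<close> shows that
  \<open>k = card V\<close> is admissible.\<close>

definition partial_gamma ::
  "'a set \<Rightarrow> 'a set set \<Rightarrow> 'a set \<Rightarrow> 'a set \<Rightarrow> int" where
  "partial_gamma V E D D' =
     int (LEAST k. 0 < k \<and> transforms V E k D D') - int (max (card D) (card D'))"

text \<open>A topological embedding of a graph in a subset \<open>S\<close> of a topological space:
  vertices are distinct points \<open>p v\<close>, an edge \<open>e\<close> is a simple arc \<open>\<gamma> e\<close>
  (in either direction) joining its ends, and arcs meet the vertices and each other
  only in common ends.\<close>

definition embeddable_in ::
  "'b::topological_space set \<Rightarrow> 'a set \<Rightarrow> 'a set set \<Rightarrow> bool" where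
  "embeddable_in S V E \<longleftrightarrow>
     (\<exists>(p :: 'a \<Rightarrow> 'b) (\<gamma> :: 'a set \<Rightarrow> real \<Rightarrow> 'b).
        inj_on p V \<and> p ` V \<subseteq> S \<and>
        (\<forall>e\<in>E. arc (\<gamma> e) \<and> path_image (\<gamma> e) \<subseteq> S \<and>
                {pathstart (\<gamma> e), pathfinish (\<gamma> e)} = p ` e \<and>
                path_image (\<gamma> e) \<inter> p ` V = p ` e) \<and>
        (\<forall>e\<in>E. \<forall>f\<in>E. e \<noteq> f \<longrightarrow>
                path_image (\<gamma> e) \<inter> path_image (\<gamma> f) = p ` (e \<inter> f)))"

definition torus :: "(complex \<times> complex) set" where
  "torus = sphere 0 1 \<times> sphere 0 1"

end

theory Submission
  imports Defs
begin

text \<open>Let \<open>5\<close> divide \<open>m\<close>. The \<open>m \<times> m\<close> torus grid has two mirror-image perfect codes,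
  \<open>x + 2 y \<equiv> 0\<close> and \<open>x - 2 y \<equiv> 0\<close> modulo \<open>5\<close>. Call a vertex clean for a set if it is
  dominated exactly once. A dominating set \<open>S\<close> has at most \<open>5 \<bar>S\<bar> - m\<^sup>2\<close> unclean vertices, so if
  all sets of a transformation have size below \<open>m\<^sup>2 / 5 + m / 110\<close>, then for any two consecutive
  sets some row lies in the middle of a band that is clean for both, and every set has a clean column band.
  On a clean region a set looks locally like one of the two codes, and which one it is, its handedness,
  does not change from a vertex to its neighbours; clean rows and columns cross, hence all of
  them have the same handedness. Adding or removing a vertex changes how often this vertex is
  dominated, so consecutive sets agree on the bands clean for both. Handedness is therefore
  preserved along the transformation, although the two codes differ in it.\<close>

section \<open>Rigidity of locally perfect codes in the square grid\<close>

definition cross :: "int \<times> int \<Rightarrow> (int \<times> int) set" where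
  "cross v = {v, v + (1, 0), v + (-1, 0), v + (0, 1), v + (0, -1)}"

definition clean :: "(int \<times> int) set \<Rightarrow> int \<times> int \<Rightarrow> bool" where
  "clean s v \<longleftrightarrow> card (cross v \<inter> s) = 1"

definition clean_box :: "(int \<times> int) set \<Rightarrow> int \<Rightarrow> int \<times> int \<Rightarrow> bool" where
  "clean_box s r v \<longleftrightarrow> (\<forall>i j. \<bar>i\<bar> \<le> r \<longrightarrow> \<bar>j\<bar> \<le> r \<longrightarrow> clean s (v + (i, j)))"

lemma clean_boxD: "clean_box s r v \<Longrightarrow> \<bar>i\<bar> \<le> r \<Longrightarrow> \<bar>j\<bar> \<le> r \<Longrightarrow> clean s (v + (i, j))"
  unfolding clean_box_def by blast

lemma clean_box_mono:
  assumes "clean_box s r v" and "\<bar>i\<bar> + k \<le> r" and "\<bar>j\<bar> + k \<le> r"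
  shows "clean_box s k (v + (i, j))"
  unfolding clean_box_def
proof (intro allI impI)
  fix a b :: int
  assume "\<bar>a\<bar> \<le> k" "\<bar>b\<bar> \<le> k"
  then have "clean s (v + (i + a, j + b))"
    using assms(2,3) by (intro clean_boxD[OF assms(1)]) linarith+
  then show "clean s (v + (i, j) + (a, b))"
    by (simp add: add.assoc)
qed

lemma clean_unique:
  assumes "clean s v" "u \<in> cross v" "w \<in> cross v" "u \<in> s" "w \<in> s"
  shows "u = w"
  using assms unfolding clean_def by (metis IntI card_1_singletonE singletonD)

lemma clean_obtain:
  assumes "clean s v"
  obtains u where "u \<in> cross v" "u \<in> s"
  using assms unfolding clean_def by (metis IntE card_1_singletonE insertI1)

lemma cross_iff: "(a, b) \<in> cross (c, d) \<longleftrightarrow> \<bar>a - c\<bar> + \<bar>b - d\<bar> \<le> 1"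
proof -
  have "(a, b) \<in> cross (c, d) \<longleftrightarrow> a = c \<and> b = d \<or> a = c + 1 \<and> b = d \<or> a = c - 1 \<and> b = d \<or>
      a = c \<and> b = d + 1 \<or> a = c \<and> b = d - 1"
    by (simp add: cross_def)
  also have "\<dots> \<longleftrightarrow> \<bar>a - c\<bar> + \<bar>b - d\<bar> \<le> 1"
    by (smt (verit))
  finally show ?thesis .
qed

lemma cross_translate: "u + (i, j) \<in> cross (u + (k, l)) \<longleftrightarrow> \<bar>i - k\<bar> + \<bar>j - l\<bar> \<le> 1"
  by (cases u) (simp add: cross_iff)

text \<open>The crosses around two points at L1 distance at most 2 share a point; two distinct
  elements of \<open>s\<close> would dominate that point twice, against cleanness.\<close>

lemma close_points_coincide:
  assumes box: "clean_box s 1 u" and us: "u \<in> s" "u + (i, j) \<in> s" and ij: "\<bar>i\<bar> + \<bar>j\<bar> \<le> 2"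
  shows "i = 0 \<and> j = 0"
proof -
  \<comment> \<open>The shared point is one unit step from \<open>u\<close> towards
    \<open>u + (i, j)\<close>, or \<open>u\<close> itself if the two already agree.\<close>
  have "\<exists>c d. \<bar>c\<bar> \<le> 1 \<and> \<bar>d\<bar> \<le> 1 \<and> \<bar>c\<bar> + \<bar>d\<bar> \<le> 1 \<and> \<bar>i - c\<bar> + \<bar>j - d\<bar> \<le> 1"
  proof (cases "i = 0")
    case True
    then show ?thesis using ij by (intro exI[of _ 0] exI[of _ "sgn j"]) (auto simp: sgn_if)
  next
    case False
    then show ?thesis using ij by (intro exI[of _ "sgn i"] exI[of _ 0]) (auto simp: sgn_if)
  qed
  then obtain c d where "\<bar>c\<bar> \<le> 1" "\<bar>d\<bar> \<le> 1" "u + (0, 0) \<in> cross (u + (c, d))"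
      "u + (i, j) \<in> cross (u + (c, d))"
    unfolding cross_translate by auto
  then have "u + (0, 0) = u + (i, j)"
    using us by (intro clean_unique[of s "u + (c, d)"] clean_boxD[OF box]) (auto simp flip: zero_prod_def)
  then show ?thesis by simp
qed

text \<open>Take \<open>(p, q) = (1, 0)\<close> and \<open>u\<close> as origin. If
  \<open>(2, -1)\<close> were missing, \<open>(2, 0)\<close> could be dominated only by
  \<open>(3, 0)\<close>, because \<open>(0, 0)\<close> and \<open>(1, 2)\<close> exclude the other
  candidates; but then nothing dominates \<open>(2, 1)\<close>.\<close>

lemma knight_step:
  assumes box: "clean_box s 3 u" and us: "u \<in> s"
    and pq: "(p, q) \<in> {(1, 0), (0, 1), (-1, 0), (0, -1)}"
    and s1: "u + (p - 2 * q, q + 2 * p) \<in> s"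
  shows "u + (2 * p + q, 2 * q - p) \<in> s"
proof (rule ccontr)
  assume n: "u + (2 * p + q, 2 * q - p) \<notin> s"
  \<comment> \<open>With the plane read as Gaussian integers, \<open>g i j\<close> adds to
    \<open>u\<close> the product of \<open>(i, j)\<close> and the unit \<open>(p, q)\<close>. In
    this turned frame one computation covers all four directions.\<close>
  define g where "g i j = u + (i * p - j * q, i * q + j * p)" for i j
  have cross_pq: "cross v = {v, v + (p, q), v + (-p, -q), v + (-q, p), v + (q, -p)}" for v
    using pq unfolding cross_def by (elim insertE emptyE Pair_inject; hypsubst; simp; blast)
  have g_shift: "g (i + 1) j = g i j + (p, q)" "g (i - 1) j = g i j + (-p, -q)"
    "g i (j + 1) = g i j + (-q, p)" "g i (j - 1) = g i j + (q, -p)" for i j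
    by (simp_all add: g_def algebra_simps)
  have cross_g: "cross (g i j) = {g i j, g (i + 1) j, g (i - 1) j, g i (j + 1), g i (j - 1)}" for i j
    unfolding g_shift by (rule cross_pq)
  have clean_g: "clean s (g i j)" if "\<bar>i\<bar> \<le> 3" "\<bar>j\<bar> \<le> 3" for i j
    using pq that unfolding g_def
    by (intro clean_boxD[OF box]; elim insertE emptyE Pair_inject; simp)
  have g_eq: "g i j = g k l \<longleftrightarrow> i = k \<and> j = l" for i j k l
    using pq unfolding g_def by (elim insertE emptyE Pair_inject; hypsubst; simp; blast)
  have g: "g 0 0 \<in> s" "g 1 2 \<in> s" "g 2 (-1) \<notin> s"
    using us s1 n by (simp_all add: g_def algebra_simps flip: zero_prod_def)
  have ex: "g k l \<notin> s" if "clean s (g a b)" "g i j \<in> cross (g a b)" "g k l \<in> cross (g a b)" "g i j \<in> s"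
     "\<not> (i = k \<and> j = l)" for a b i j k l
    using clean_unique[OF that(1-3)] that g_eq by blast
  have dom: "g i j \<in> s \<or> g (i + 1) j \<in> s \<or> g (i - 1) j \<in> s \<or> g i (j + 1) \<in> s \<or> g i (j - 1) \<in> s"
    if "\<bar>i\<bar> \<le> 3" "\<bar>j\<bar> \<le> 3" for i j
    using clean_obtain[OF clean_g[OF that]] unfolding cross_g by blast
  have 1: "g 1 0 \<notin> s" "g 2 0 \<notin> s"
    by (rule ex[of 1 0 0 0]; simp add: clean_g cross_g g)+
  have 2: "g 1 1 \<notin> s" "g 2 1 \<notin> s"
    by (rule ex[of 1 1 1 2]; simp add: clean_g cross_g g)+
  have 3: "g 2 2 \<notin> s"
    by (rule ex[of 1 2 1 2]; simp add: clean_g cross_g g)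
  have 4: "g 3 0 \<in> s"
    using dom[of 2 0] 1 2 g by simp
  have 5: "g 3 1 \<notin> s"
    by (rule ex[of 3 0 3 0]; simp add: clean_g cross_g 4)
  \<comment> \<open>All five points of the cross around \<open>g 2 1\<close> are now
    excluded.\<close>
  show False
    using dom[of 2 1] 1 2 3 5 by simp
qed

text \<open>The four quarter turns in \<open>knight_step\<close> close a cycle of implications, so
  the turns of \<open>(1, 2)\<close> stand or fall together. The mirror images \<open>(2, 1)\<close>
  and \<open>(1, 2)\<close> are too close to occur both, and domination of \<open>(1, 1)\<close>
  requires one of them. So each element of \<open>s\<close> has exactly one of two types.\<close>

lemma knight_pattern:
  assumes box: "clean_box s 3 u" and us: "u \<in> s"
  shows "u + (2, -1) \<in> s \<longleftrightarrow> u + (1, 2) \<in> s" "u + (-1, -2) \<in> s \<longleftrightarrow> u + (1, 2) \<in> s"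
    "u + (-2, 1) \<in> s \<longleftrightarrow> u + (1, 2) \<in> s"
    "u + (2, 1) \<in> s \<longleftrightarrow> u + (1, 2) \<notin> s" "u + (1, -2) \<in> s \<longleftrightarrow> u + (1, 2) \<notin> s"
    "u + (-2, -1) \<in> s \<longleftrightarrow> u + (1, 2) \<notin> s" "u + (-1, 2) \<in> s \<longleftrightarrow> u + (1, 2) \<notin> s"
proof -
  note k = knight_step[OF box us]
  show a: "u + (2, -1) \<in> s \<longleftrightarrow> u + (1, 2) \<in> s" "u + (-1, -2) \<in> s \<longleftrightarrow> u + (1, 2) \<in> s"
    "u + (-2, 1) \<in> s \<longleftrightarrow> u + (1, 2) \<in> s"
    using k[of 1 0] k[of 0 1] k[of "-1" 0] k[of 0 "-1"] by auto
  have box1: "clean_box s 1 (u + (i, j))" if "\<bar>i\<bar> \<le> 2" "\<bar>j\<bar> \<le> 2" for i j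
    using that by (intro clean_box_mono[OF box]) auto
  have mirror: "u + (2 * p - q, 2 * q + p) \<in> s \<longleftrightarrow> u + (p - 2 * q, q + 2 * p) \<notin> s"
    if pq: "(p, q) \<in> {(1, 0), (0, 1), (-1, 0), (0, -1)}" for p q
  proof
    show "u + (p - 2 * q, q + 2 * p) \<notin> s" if "u + (2 * p - q, 2 * q + p) \<in> s"
    proof
      assume "u + (p - 2 * q, q + 2 * p) \<in> s"
      then have "p + q = 0 \<and> q - p = 0"
        using pq that by (intro close_points_coincide[OF box1[of "p - 2 * q" "q + 2 * p"]]) (auto simp: add.assoc)
      with pq show False by auto
    qed
    show "u + (2 * p - q, 2 * q + p) \<in> s" if n: "u + (p - 2 * q, q + 2 * p) \<notin> s"
    proof -
      \<comment> \<open>This point is \<open>(1, 1)\<close> in the turned frame. Its cross consists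
        of three points within distance 2 of \<open>u\<close> and the two competing knight
        moves.\<close>
      have "clean s (u + (p - q, p + q))"
        using pq by (intro clean_boxD[OF box]) auto
      then obtain w where w: "w \<in> cross (u + (p - q, p + q))" "w \<in> s"
        by (rule clean_obtain)
      have "u + (i, j) \<notin> s" if "\<bar>i\<bar> + \<bar>j\<bar> \<le> 2" "(i, j) \<noteq> 0" for i j
        using close_points_coincide[OF box1[of 0 0], of i j] us that by (auto simp: zero_prod_def[symmetric])
      from this[of "p - q" "p + q"] this[of p q] this[of "-q" "p"] w n pq
      show ?thesis
        by (auto simp: cross_def add.assoc zero_prod_def)
    qed
  qed
  show "u + (2, 1) \<in> s \<longleftrightarrow> u + (1, 2) \<notin> s" "u + (1, -2) \<in> s \<longleftrightarrow> u + (1, 2) \<notin> s"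
    "u + (-2, -1) \<in> s \<longleftrightarrow> u + (1, 2) \<notin> s" "u + (-1, 2) \<in> s \<longleftrightarrow> u + (1, 2) \<notin> s"
    using mirror[of 1 0] mirror[of 0 1] mirror[of "-1" 0] mirror[of 0 "-1"] a by auto
qed

text \<open>Nonzero offsets of length at most 2 are too short. Those of length 3 are knight moves or
  axis offsets such as \<open>(3, 0)\<close>; of \<open>(2, 1)\<close> and \<open>(2, -1)\<close>
  exactly one gives an element of \<open>s\<close>, and both are within distance 2 of
  \<open>(3, 0)\<close>.\<close>

lemma code_difference:
  assumes box: "clean_box s 3 u" and us: "u \<in> s" "u + (i, j) \<in> s" and ij: "\<bar>i\<bar> + \<bar>j\<bar> \<le> 3"
  shows "(i, j) \<in> {(0, 0), (1, 2), (2, -1), (-1, -2), (-2, 1), (2, 1), (1, -2), (-2, -1), (-1, 2)}"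
proof (cases "\<bar>i\<bar> + \<bar>j\<bar> \<le> 2")
  case True
  have "clean_box s 1 (u + (0, 0))"
    by (intro clean_box_mono[OF box]) auto
  then have "i = 0 \<and> j = 0"
    using us True by (intro close_points_coincide) (auto simp flip: zero_prod_def)
  then show ?thesis by simp
next
  case False
  have close: "i = k \<and> j = l"
    if "u + (k, l) \<in> s" "\<bar>k\<bar> \<le> 2" "\<bar>l\<bar> \<le> 2" "\<bar>i - k\<bar> + \<bar>j - l\<bar> \<le> 2" for k l
  proof -
    have "clean_box s 1 (u + (k, l))"
      using that by (intro clean_box_mono[OF box]) auto
    moreover have "u + (k, l) + (i - k, j - l) \<in> s"
      using us by (simp add: add.assoc)
    ultimately have "i - k = 0 \<and> j - l = 0"
      using that by (intro close_points_coincide)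
    then show ?thesis by simp
  qed
  note p = knight_pattern[OF box us(1)]
  consider "i = 3" "j = 0" | "i = -3" "j = 0" | "i = 0" "j = 3" | "i = 0" "j = -3"
    | "\<bar>i\<bar> = 2" "\<bar>j\<bar> = 1" | "\<bar>i\<bar> = 1" "\<bar>j\<bar> = 2"
    using ij False by (smt (verit))
  then show ?thesis
  proof cases
    case 1
    then show ?thesis using close[of 2 "-1"] close[of 2 1] p by auto
  next
    case 2
    then show ?thesis using close[of "-2" "-1"] close[of "-2" 1] p by auto
  next
    case 3
    then show ?thesis using close[of "-1" 2] close[of 1 2] p by auto
  next
    case 4
    then show ?thesis using close[of "-1" "-2"] close[of 1 "-2"] p by auto
  next
    case 5
    then have "i = 2 \<or> i = -2" "j = 1 \<or> j = -1" by linarith+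
    then show ?thesis by (elim disjE) simp_all
  next
    case 6
    then have "i = 1 \<or> i = -1" "j = 2 \<or> j = -2" by linarith+
    then show ?thesis by (elim disjE) simp_all
  qed
qed

text \<open>The offset from \<open>w\<close> to \<open>u\<close> is the negative of the one from
  \<open>u\<close> to \<open>w\<close>. A knight move and its negative have the same handedness, so
  this one offset determines both types; offset 0 is trivial.\<close>

lemma knight_type_eq:
  assumes box: "clean_box s 3 u" "clean_box s 3 w" and us: "u \<in> s" "w \<in> s"
    and d: "w = u + (i, j)" "\<bar>i\<bar> + \<bar>j\<bar> \<le> 3"
  shows "u + (1, 2) \<in> s \<longleftrightarrow> w + (1, 2) \<in> s"
proof -
  note p = knight_pattern[OF box(1) us(1)] and q = knight_pattern[OF box(2) us(2)]
  have w: "u + (i, j) \<in> s" and u: "w + (-i, -j) \<in> s"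
    using us d by (simp_all add: add.assoc flip: zero_prod_def)
  have "(i, j) \<in> {(0, 0), (1, 2), (2, -1), (-1, -2), (-2, 1), (2, 1), (1, -2), (-2, -1), (-1, 2)}"
    using code_difference[OF box(1) us(1) w d(2)] .
  then show ?thesis
    using w u p q d(1) by (elim insertE emptyE Pair_inject; simp flip: zero_prod_def)
qed

text \<open>Handedness is attached to all vertices, not only to elements of \<open>s\<close>, so
  that neighbours can be compared. At a clean \<open>v\<close> the only candidate for
  \<open>u\<close> is the unique element dominating \<open>v\<close>.\<close>

definition right_handed :: "(int \<times> int) set \<Rightarrow> int \<times> int \<Rightarrow> bool" where
  "right_handed s v \<longleftrightarrow> (\<exists>u\<in>cross v. u \<in> s \<and> u + (1, 2) \<in> s)"

lemma cross_offset:
  assumes "w \<in> cross (u + (k, l))"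
  obtains i j where "w = u + (i, j)" "\<bar>i - k\<bar> + \<bar>j - l\<bar> \<le> 1"
proof
  show "w = u + (fst w - fst u, snd w - snd u)"
    by (simp add: prod_eq_iff)
  then show "\<bar>fst w - fst u - k\<bar> + \<bar>snd w - snd u - l\<bar> \<le> 1"
    using assms cross_translate by metis
qed

text \<open>Elements dominating two neighbours are at distance at most 3, so
  \<open>knight_type_eq\<close> applies to them. The radius 5 is 2 + 3: an element dominating the
  neighbour is within 2 of \<open>v\<close> and needs a clean box of radius 3.\<close>

lemma right_handed_step:
  assumes box: "clean_box s 5 v" and ab: "\<bar>a\<bar> + \<bar>b\<bar> \<le> 1"
  shows "right_handed s (v + (a, b)) \<longleftrightarrow> right_handed s v"
proof -
  have type: "u + (1, 2) \<in> s \<longleftrightarrow> w + (1, 2) \<in> s"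
    if u: "u \<in> cross v" "u \<in> s" and w: "w \<in> cross (v + (a, b))" "w \<in> s" for u w
  proof -
    have "u \<in> cross (v + (0, 0))" using u by (simp flip: zero_prod_def)
    then obtain i j where ij: "u = v + (i, j)" "\<bar>i - 0\<bar> + \<bar>j - 0\<bar> \<le> 1"
      by (rule cross_offset)
    obtain k l where kl: "w = v + (k, l)" "\<bar>k - a\<bar> + \<bar>l - b\<bar> \<le> 1"
      using w(1) by (rule cross_offset)
    show ?thesis
    proof (rule knight_type_eq)
      show "clean_box s 3 u" "clean_box s 3 w"
        unfolding ij kl using ij(2) kl(2) ab by (auto intro!: clean_box_mono[OF box])
      show "w = u + (k - i, l - j)"
        unfolding ij kl by (simp add: add.assoc)
      show "\<bar>k - i\<bar> + \<bar>l - j\<bar> \<le> 3"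
        using ij(2) kl(2) ab by linarith
    qed (use u w in auto)
  qed
  have "clean s (v + (0, 0))" "clean s (v + (a, b))"
    using ab by (auto intro!: clean_boxD[OF box])
  then have "clean s v" "clean s (v + (a, b))"
    by (simp_all flip: zero_prod_def)
  then show ?thesis
    unfolding right_handed_def using type clean_obtain by metis
qed

section \<open>Domination in regular graphs\<close>

text \<open>Double counting: being in the closed neighborhood is symmetric, and each element of
  \<open>S\<close> lies in \<open>d + 1\<close> closed neighborhoods.\<close>

lemma sum_closed_neighborhoods:
  assumes G: "finite_simple_graph V E" "regular d V E" and S: "S \<subseteq> V"
  shows "(\<Sum>v\<in>V. card (insert v (neighbors E v) \<inter> S)) = (d + 1) * card S"
proof -
  define N where "N v = insert v (neighbors E v)" for v
  have finV: "finite V" and edge: "\<And>e. e \<in> E \<Longrightarrow> e \<subseteq> V \<and> card e = 2"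
    using G(1) unfolding finite_simple_graph_def by auto
  have sub: "neighbors E v \<subseteq> V - {v}" for v
    unfolding neighbors_def using edge by fastforce
  have cardN: "card (N v) = d + 1" if "v \<in> V" for v
  proof -
    have "finite (neighbors E v)" "v \<notin> neighbors E v"
      using sub[of v] finV finite_subset by blast+
    then show ?thesis
      using G(2) that unfolding regular_def N_def by simp
  qed
  have sym: "v \<in> N w \<longleftrightarrow> w \<in> N v" for v w
    unfolding N_def neighbors_def by (auto simp: insert_commute)
  have finS: "finite S" using S finV finite_subset by blast
  have "(\<Sum>v\<in>V. card (N v \<inter> S)) = (\<Sum>v\<in>V. \<Sum>w\<in>S. of_bool (w \<in> N v))"
    using finS by (simp add: sum.If_cases of_bool_def Int_commute)
  also have "\<dots> = (\<Sum>w\<in>S. \<Sum>v\<in>V. of_bool (v \<in> N w))"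
    by (subst sum.swap) (simp add: sym)
  also have "\<dots> = (\<Sum>w\<in>S. card (N w))"
  proof (rule sum.cong)
    fix w assume "w \<in> S"
    then have "N w \<subseteq> V" using S sub unfolding N_def by auto
    then have "V \<inter> N w = N w" by blast
    then show "(\<Sum>v\<in>V. of_bool (v \<in> N w)) = card (N w)"
      using finV by (simp add: sum.If_cases of_bool_def)
  qed simp
  also have "\<dots> = (d + 1) * card S"
    using cardN S by (simp add: subset_iff)
  finally show ?thesis unfolding N_def .
qed

text \<open>In the sum of \<open>sum_closed_neighborhoods\<close> every term is at least 1, and at
  least 2 at the vertices counted here.\<close>

lemma card_multiply_dominated:
  assumes G: "finite_simple_graph V E" "regular d V E" and S: "dominating V E S"
  shows "card {v \<in> V. card (insert v (neighbors E v) \<inter> S) \<noteq> 1} + card V \<le> (d + 1) * card S"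
proof -
  let ?N = "\<lambda>v. insert v (neighbors E v) \<inter> S"
  have finV: "finite V" using G(1) unfolding finite_simple_graph_def by auto
  have SV: "S \<subseteq> V" using S unfolding dominating_def by auto
  have "1 \<le> card (?N v)" if "v \<in> V" for v
  proof -
    have "finite (?N v)" using SV finV finite_subset by blast
    moreover have "?N v \<noteq> {}" using S that unfolding dominating_def by auto
    ultimately show ?thesis by (simp add: Suc_le_eq card_gt_0_iff)
  qed
  then have "(\<Sum>v\<in>V. of_bool (card (?N v) \<noteq> 1) + 1) \<le> (\<Sum>v\<in>V. card (?N v))"
    by (intro sum_mono) (force simp: of_bool_def)
  moreover have "(\<Sum>v\<in>V. of_bool (card (?N v) \<noteq> 1) + 1) = card {v \<in> V. card (?N v) \<noteq> 1} + card V"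
    using finV by (simp only: sum.distrib sum_of_bool_eq) (simp add: Int_def)
  ultimately show ?thesis
    using sum_closed_neighborhoods[OF G SV] by simp
qed

section \<open>Transformations through the full vertex set\<close>

lemma dominating_mono:
  "dominating V E S \<Longrightarrow> S \<subseteq> T \<Longrightarrow> T \<subseteq> V \<Longrightarrow> dominating V E T"
  unfolding dominating_def by blast

lemma transforms_refl: "dominating V E D \<Longrightarrow> card D \<le> k \<Longrightarrow> transforms V E k D D"
  unfolding transforms_def by (intro exI[of _ 0] exI[of _ "\<lambda>_. D"]) simp

lemma transforms_Cons:
  assumes "dominating V E C" "card C \<le> k" "adjacent_sets C D" "transforms V E k D D'"
  shows "transforms V E k C D'"
proof -
  obtain l :: nat and S where S: "S 0 = D" "S l = D'"
      "\<forall>i\<in>{0..l}. dominating V E (S i) \<and> card (S i) \<le> k"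
      "\<forall>i\<in>{1..l}. adjacent_sets (S (i - 1)) (S i)"
    using assms(4) unfolding transforms_def by metis
  define T where "T i = (case i of 0 \<Rightarrow> C | Suc j \<Rightarrow> S j)" for i
  have "dominating V E (T i) \<and> card (T i) \<le> k" if "i \<le> Suc l" for i
    using S(3) assms(1,2) that by (cases i) (auto simp: T_def)
  moreover have "adjacent_sets (T (i - 1)) (T i)" if i: "1 \<le> i" "i \<le> Suc l" for i
  proof -
    from i obtain j where j: "i = Suc j" by (cases i) auto
    show ?thesis
    proof (cases j)
      case 0
      then show ?thesis using assms(3) S(1) j by (simp add: T_def)
    next
      case (Suc a)
      then show ?thesis using S(4)[rule_format, of j] i j by (simp add: T_def)
    qed
  qed
  ultimately show ?thesis
    unfolding transforms_def using S(2)
    by (intro exI[of _ "Suc l"] exI[of _ T]) (auto simp: T_def)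
qed

lemma transforms_up:
  assumes V: "finite V" and D: "dominating V E D" and k: "card V \<le> k"
    and T: "transforms V E k V D'"
  shows "transforms V E k D D'"
  using D
proof (induction "card (V - D)" arbitrary: D)
  case 0
  then have "D = V" using V unfolding dominating_def by auto
  with T show ?case by simp
next
  case (Suc n)
  then obtain x where x: "x \<in> V" "x \<notin> D"
    by (metis card.empty Diff_iff ex_in_conv nat.distinct(1))
  have DV: "D \<subseteq> V" using Suc.prems unfolding dominating_def by blast
  have "V - insert x D = V - D - {x}" by blast
  then have c: "n = card (V - insert x D)"
    using Suc.hyps(2) x by simp
  have "dominating V E (insert x D)"
    using dominating_mono[OF Suc.prems] DV x by blast
  then have "transforms V E k (insert x D) D'"
    by (rule Suc.hyps(1)[OF c])
  moreover have "adjacent_sets D (insert x D)"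
    using x by (simp add: adjacent_sets_def insert_Diff_if)
  ultimately show ?case
    using transforms_Cons Suc.prems DV V k card_mono le_trans by metis
qed

lemma transforms_down:
  assumes V: "finite V" and D: "dominating V E D" and k: "card V \<le> k"
    and C: "D \<subseteq> C" "C \<subseteq> V"
  shows "transforms V E k C D"
  using C
proof (induction "card (C - D)" arbitrary: C)
  case 0
  then have "C = D" using V by (auto dest: finite_subset)
  then show ?case using transforms_refl D 0 V k card_mono le_trans by metis
next
  case (Suc n)
  then obtain x where x: "x \<in> C" "x \<notin> D"
    by (metis card.empty Diff_iff ex_in_conv nat.distinct(1))
  have "C - {x} - D = C - D - {x}" by blast
  then have c: "n = card (C - {x} - D)"
    using Suc.hyps(2) x by simp
  have "transforms V E k (C - {x}) D"
    using Suc.prems x by (intro Suc.hyps(1)[OF c]) blast+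
  moreover have "C - {x} - C = {}" "C - (C - {x}) = {x}" using x by blast+
  then have "adjacent_sets C (C - {x})"
    unfolding adjacent_sets_def by (simp only: card.empty) simp
  moreover have "dominating V E C" using dominating_mono[OF D] Suc.prems by blast
  moreover have "card C \<le> k" using Suc.prems V k card_mono le_trans by metis
  ultimately show ?case using transforms_Cons by metis
qed

text \<open>First grow \<open>D\<close> to \<open>V\<close>, then shrink to \<open>D'\<close>. This
  shows that some bound is admissible, so the \<open>LEAST\<close> in \<open>partial_gamma\<close>
  is attained.\<close>

lemma transforms_card:
  assumes "finite V" "dominating V E D" "dominating V E D'"
  shows "transforms V E (card V) D D'"
proof (rule transforms_up)
  show "transforms V E (card V) V D'"
    using assms by (intro transforms_down) (auto simp: dominating_def)
qed (use assms in auto)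

section \<open>The torus grid\<close>

locale torus_grid =
  fixes m :: int
  assumes m_ge: "5 \<le> m"
begin

text \<open>The covering map from the integer plane to the torus grid, with the two residues packed
  into one natural number. Its preimages turn vertex sets into periodic sets of the plane, to which
  the rigidity results apply.\<close>

definition enc :: "int \<times> int \<Rightarrow> nat" where
  "enc v = nat ((fst v mod m) * m + snd v mod m)"

definition verts :: "nat set" where
  "verts = range enc"

definition edges :: "nat set set" where
  "edges = {{enc v, enc (v + d)} | v d. d \<in> {(1, 0), (0, 1)}}"

lemma int_enc: "int (enc v) = (fst v mod m) * m + snd v mod m"
  using m_ge unfolding enc_def by simp

lemma enc_div: "int (enc v) div m = fst v mod m"
  and enc_mod: "int (enc v) mod m = snd v mod m"
  using m_ge by (simp_all add: int_enc)

lemma enc_eq_iff: "enc v = enc w \<longleftrightarrow> fst v mod m = fst w mod m \<and> snd v mod m = snd w mod m"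
  by (metis enc_div enc_mod int_enc of_nat_eq_iff)

lemma enc_add_cong: "enc v = enc w \<Longrightarrow> enc (v + d) = enc (w + d)"
  unfolding enc_eq_iff by (auto intro: mod_add_cong)

lemma enc_add_iff: "enc (v + d) = enc (w + d) \<longleftrightarrow> enc v = enc w"
  using enc_add_cong[of "v + d" "w + d" "-d"] enc_add_cong[of v w d] by auto

lemma small_mod_eq:
  assumes "\<bar>a - b\<bar> < m" "a mod m = b mod m"
  shows "a = b"
  using assms zdvd_imp_le[of m "\<bar>a - b\<bar>"] m_ge by (auto simp: mod_eq_dvd_iff)

lemma enc_inj_close:
  assumes "\<bar>fst v - fst w\<bar> < m" "\<bar>snd v - snd w\<bar> < m" "enc v = enc w"
  shows "v = w"
  using assms small_mod_eq by (auto simp: enc_eq_iff prod_eq_iff)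

lemma inj_on_enc_cross: "inj_on enc (cross v)"
proof (rule inj_onI)
  fix a b assume "a \<in> cross v" "b \<in> cross v" and e: "enc a = enc b"
  then have "\<bar>fst a - fst v\<bar> + \<bar>snd a - snd v\<bar> \<le> 1" "\<bar>fst b - fst v\<bar> + \<bar>snd b - snd v\<bar> \<le> 1"
    using cross_iff by (metis prod.collapse)+
  then show "a = b"
    using m_ge by (intro enc_inj_close[OF _ _ e]) linarith+
qed

lemma card_cross: "card (cross v) = 5"
  unfolding cross_def by (cases v) simp

lemma bij_enc: "bij_betw enc ({0..<m} \<times> {0..<m}) verts"
  unfolding bij_betw_def
proof
  show "inj_on enc ({0..<m} \<times> {0..<m})"
    by (rule inj_onI) (auto simp: enc_eq_iff)
  have "enc v \<in> enc ` ({0..<m} \<times> {0..<m})" for v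
    using m_ge by (intro image_eqI[of _ _ "(fst v mod m, snd v mod m)"]) (auto simp: enc_eq_iff)
  then show "enc ` ({0..<m} \<times> {0..<m}) = verts"
    unfolding verts_def by blast
qed

lemma finite_verts: "finite verts"
  using bij_betw_finite[OF bij_enc] by simp

lemma card_verts: "card verts = nat m * nat m"
  using bij_betw_same_card[OF bij_enc] by (simp add: card_cartesian_product)

lemma edge_ends_distinct: "d \<in> {(1, 0), (0, 1)} \<Longrightarrow> enc v \<noteq> enc (v + d)"
  using enc_inj_close[of v "v + d"] m_ge by (auto simp: prod_eq_iff)

lemma finite_simple: "finite_simple_graph verts edges"
  unfolding finite_simple_graph_def
proof (intro conjI ballI finite_verts)
  fix e assume "e \<in> edges"
  then obtain v d where "e = {enc v, enc (v + d)}" "d \<in> {(1, 0), (0, 1)}"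
    unfolding edges_def by blast
  then show "e \<subseteq> verts" "card e = 2"
    using edge_ends_distinct[of d v] by (auto simp: verts_def)
qed

lemma neighbors_enc:
  "neighbors edges (enc v) = enc ` {v + (1, 0), v + (-1, 0), v + (0, 1), v + (0, -1)}"
proof -
  have shift: "enc v = enc (w + d) \<longleftrightarrow> enc w = enc (v - d)" for w d
    using enc_add_iff[of "v - d" d w] by auto
  have "u \<in> neighbors edges (enc v) \<longleftrightarrow>
      (\<exists>d\<in>{(1, 0), (0, 1)}. u = enc (v + d) \<or> u = enc (v - d))" for u
  proof -
    have "u \<in> neighbors edges (enc v) \<longleftrightarrow>
      (\<exists>d\<in>{(1, 0), (0, 1)}. \<exists>w. u = enc w \<and> enc v = enc (w + d) \<or> u = enc (w + d) \<and> enc v = enc w)"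
      unfolding neighbors_def edges_def mem_Collect_eq doubleton_eq_iff by blast
    also have "\<dots> \<longleftrightarrow> (\<exists>d\<in>{(1, 0), (0, 1)}. u = enc (v + d) \<or> u = enc (v - d))"
      using shift enc_add_cong by metis
    finally show ?thesis .
  qed
  then have "neighbors edges (enc v) = (\<Union>d\<in>{(1, 0), (0, 1)}. {enc (v + d), enc (v - d)})"
    by blast
  then show ?thesis by (simp add: insert_commute diff_conv_add_uminus del: add_uminus_conv_diff)
qed

lemma closed_neighborhood_enc: "insert (enc v) (neighbors edges (enc v)) = enc ` cross v"
  unfolding neighbors_enc cross_def by simp

lemma regular4: "regular 4 verts edges"
  unfolding regular_def
proof
  fix u assume "u \<in> verts"
  then obtain v where v: "u = enc v" unfolding verts_def by blast
  have "card (insert u (neighbors edges u)) = 5"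
    unfolding v closed_neighborhood_enc using card_image[OF inj_on_enc_cross] card_cross by simp
  moreover have "u \<notin> neighbors edges u"
    using finite_simple unfolding neighbors_def finite_simple_graph_def by fastforce
  moreover have "finite (neighbors edges u)" unfolding v neighbors_enc by simp
  ultimately show "card (neighbors edges u) = 4" by simp
qed

text \<open>Since \<open>enc\<close> is injective on crosses, cleanness in the plane can be counted
  in the finite graph.\<close>

lemma clean_enc:
  "clean (enc -` S) v \<longleftrightarrow> card (insert (enc v) (neighbors edges (enc v)) \<inter> S) = 1"
proof -
  have "enc ` cross v \<inter> S = enc ` (cross v \<inter> enc -` S)" by blast
  moreover have "card (enc ` (cross v \<inter> enc -` S)) = card (cross v \<inter> enc -` S)"
    by (intro card_image inj_on_subset[OF inj_on_enc_cross]) blast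
  ultimately show ?thesis unfolding clean_def closed_neighborhood_enc by simp
qed

section \<open>Unclean vertices, good rows and good columns\<close>

definition unclean :: "nat set \<Rightarrow> nat set" where
  "unclean S = {u \<in> verts. card (insert u (neighbors edges u) \<inter> S) \<noteq> 1}"

lemma enc_unclean: "enc v \<in> unclean S \<longleftrightarrow> \<not> clean (enc -` S) v"
  unfolding unclean_def clean_enc by (simp add: verts_def)

lemma card_unclean: "dominating verts edges S \<Longrightarrow> card (unclean S) + card verts \<le> 5 * card S"
  using card_multiply_dominated[OF finite_simple regular4] unfolding unclean_def by simp

text \<open>The radius 5 is what \<open>right_handed_step\<close> requires, so handedness can travel
  along the whole row.\<close>

definition good_row :: "nat set \<Rightarrow> int \<Rightarrow> bool" where
  "good_row S y \<longleftrightarrow> (\<forall>x. clean_box (enc -` S) 5 (x, y))"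

definition good_column :: "nat set \<Rightarrow> int \<Rightarrow> bool" where
  "good_column S x \<longleftrightarrow> (\<forall>y. clean_box (enc -` S) 5 (x, y))"

text \<open>An unclean vertex spoils only the 11 rows at vertical distance at most 5 from
  it.\<close>

lemma card_bad_rows: "card {y \<in> {0..<m}. \<not> good_row S y} \<le> 11 * card (unclean S)"
proof -
  \<comment> \<open>Recovers the spoiled row from the second coordinate of the unclean vertex and
    the vertical offset.\<close>
  let ?f = "\<lambda>(u, j). (int u mod m - j) mod m"
  have fin: "finite (unclean S)" using finite_verts unfolding unclean_def by simp
  have "{y \<in> {0..<m}. \<not> good_row S y} \<subseteq> ?f ` (unclean S \<times> {-5..5})"
  proof
    fix y assume "y \<in> {y \<in> {0..<m}. \<not> good_row S y}"
    then obtain x i j where y: "0 \<le> y" "y < m" and ij: "\<bar>j\<bar> \<le> 5" "\<not> clean (enc -` S) ((x, y) + (i, j))"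
      unfolding good_row_def clean_box_def by auto
    have "y = ?f (enc ((x, y) + (i, j)), j)"
      using y by (simp only: prod.case enc_mod) (simp add: mod_diff_left_eq)
    moreover have "(enc ((x, y) + (i, j)), j) \<in> unclean S \<times> {-5..5}"
      using ij by (simp add: enc_unclean abs_le_iff)
    ultimately show "y \<in> ?f ` (unclean S \<times> {-5..5})"
      by (rule image_eqI)
  qed
  then have "card {y \<in> {0..<m}. \<not> good_row S y} \<le> card (unclean S \<times> {-5..5::int})"
    using fin by (intro surj_card_le) auto
  then show ?thesis by (simp add: card_cartesian_product mult.commute)
qed

lemma card_bad_columns: "card {x \<in> {0..<m}. \<not> good_column S x} \<le> 11 * card (unclean S)"
proof -
  let ?f = "\<lambda>(u, i). (int u div m - i) mod m"
  have fin: "finite (unclean S)" using finite_verts unfolding unclean_def by simp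
  have "{x \<in> {0..<m}. \<not> good_column S x} \<subseteq> ?f ` (unclean S \<times> {-5..5})"
  proof
    fix x assume "x \<in> {x \<in> {0..<m}. \<not> good_column S x}"
    then obtain y i j where x: "0 \<le> x" "x < m" and ij: "\<bar>i\<bar> \<le> 5" "\<not> clean (enc -` S) ((x, y) + (i, j))"
      unfolding good_column_def clean_box_def by auto
    have "x = ?f (enc ((x, y) + (i, j)), i)"
      using x by (simp add: enc_div mod_diff_left_eq)
    moreover have "(enc ((x, y) + (i, j)), i) \<in> unclean S \<times> {-5..5}"
      using ij by (simp add: enc_unclean abs_le_iff)
    ultimately show "x \<in> ?f ` (unclean S \<times> {-5..5})"
      by (rule image_eqI)
  qed
  then have "card {x \<in> {0..<m}. \<not> good_column S x} \<le> card (unclean S \<times> {-5..5::int})"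
    using fin by (intro surj_card_le) auto
  then show ?thesis by (simp add: card_cartesian_product mult.commute)
qed

lemma exists_good_column:
  assumes "11 * card (unclean S) < nat m"
  shows "\<exists>x. good_column S x"
proof (rule ccontr)
  assume "\<nexists>x. good_column S x"
  then have "{x \<in> {0..<m}. \<not> good_column S x} = {0..<m}" by auto
  then show False using card_bad_columns[of S] assms by simp
qed

text \<open>Otherwise the bad rows of \<open>S\<close> and \<open>T\<close> together would cover all
  \<open>m\<close> rows, more than \<open>card_bad_rows\<close> permits.\<close>

lemma exists_common_good_row:
  assumes "11 * card (unclean S) + 11 * card (unclean T) < nat m"
  shows "\<exists>y. good_row S y \<and> good_row T y"
proof (rule ccontr)
  let ?B = "\<lambda>S. {y \<in> {0..<m}. \<not> good_row S y}"
  assume "\<nexists>y. good_row S y \<and> good_row T y"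
  then have "{0..<m} = ?B S \<union> ?B T" by auto
  then have "nat m \<le> card (?B S) + card (?B T)"
    by (metis card_Un_le card_atLeastLessThan_int diff_zero)
  then show False using card_bad_rows[of S] card_bad_rows[of T] assms by linarith
qed

end

section \<open>Invariance of handedness\<close>

lemma int_step_invariant:
  fixes P :: "int \<Rightarrow> bool"
  assumes "\<And>i. P (i + 1) \<longleftrightarrow> P i"
  shows "P i \<longleftrightarrow> P j"
proof -
  have "P i \<longleftrightarrow> P 0" for i
    by (induction i rule: int_induct[where k = 0]) (use assms in \<open>metis diff_add_cancel\<close>)+
  then show ?thesis by blast
qed

text \<open>The intersections of the cross with \<open>s\<close> and \<open>t\<close> are nested and
  of the same size, hence equal. This is what lets consecutive sets of a transformation be
  compared.\<close>

lemma clean_subset_eq: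
  assumes "s \<subseteq> t" "clean s v" "clean t v"
  shows "v \<in> s \<longleftrightarrow> v \<in> t"
proof -
  have "cross v \<inter> s = cross v \<inter> t"
    using assms by (intro card_subset_eq) (auto simp: clean_def cross_def)
  then show ?thesis unfolding cross_def by blast
qed

lemma adjacent_sets_subset:
  assumes "adjacent_sets S T" "finite S" "finite T"
  shows "S \<subseteq> T \<or> T \<subseteq> S"
proof -
  have "card (S - T) = 0 \<or> card (T - S) = 0"
    using assms(1) unfolding adjacent_sets_def by linarith
  then show ?thesis using assms(2,3) by auto
qed

context torus_grid
begin

lemma right_handed_row:
  assumes "good_row S y"
  shows "right_handed (enc -` S) (x, y) \<longleftrightarrow> right_handed (enc -` S) (x', y)"
proof (rule int_step_invariant)
  show "right_handed (enc -` S) (i + 1, y) \<longleftrightarrow> right_handed (enc -` S) (i, y)" for i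
    using right_handed_step[of "enc -` S" "(i, y)" 1 0] assms unfolding good_row_def by simp
qed

lemma right_handed_column:
  assumes "good_column S x"
  shows "right_handed (enc -` S) (x, y) \<longleftrightarrow> right_handed (enc -` S) (x, y')"
proof (rule int_step_invariant)
  show "right_handed (enc -` S) (x, i + 1) \<longleftrightarrow> right_handed (enc -` S) (x, i)" for i
    using right_handed_step[of "enc -` S" "(x, i)" 0 1] assms unfolding good_column_def by simp
qed

text \<open>The bound provides a good column; it crosses both rows, so handedness travels along one
  row, the column and the other row.\<close>

lemma right_handed_rows:
  assumes "11 * card (unclean S) < nat m" "good_row S y" "good_row S y'"
  shows "right_handed (enc -` S) (x, y) \<longleftrightarrow> right_handed (enc -` S) (x', y')"
  using exists_good_column[OF assms(1)] right_handed_row[OF assms(2)] right_handed_row[OF assms(3)]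
    right_handed_column by metis

text \<open>By \<open>clean_subset_eq\<close> the two sets agree within distance 5 of the row, and
  handedness at \<open>(x, y)\<close> inspects only points with offsets at most 2 and 3.\<close>

lemma right_handed_subset:
  assumes "S \<subseteq> T" "good_row S y" "good_row T y"
  shows "right_handed (enc -` S) (x, y) \<longleftrightarrow> right_handed (enc -` T) (x, y)"
proof -
  have eq: "(x, y) + (i, j) \<in> enc -` S \<longleftrightarrow> (x, y) + (i, j) \<in> enc -` T" if "\<bar>i\<bar> \<le> 5" "\<bar>j\<bar> \<le> 5" for i j
  proof (rule clean_subset_eq)
    show "enc -` S \<subseteq> enc -` T" using assms(1) by blast
  qed (use assms that in \<open>auto simp: good_row_def dest: clean_boxD simp del: add_Pair\<close>)
  have "u \<in> enc -` S \<and> u + (1, 2) \<in> enc -` S \<longleftrightarrow> u \<in> enc -` T \<and> u + (1, 2) \<in> enc -` T"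
    if "u \<in> cross (x, y)" for u
  proof -
    from that have "u \<in> cross ((x, y) + (0, 0))" by simp
    then obtain i j where ij: "u = (x, y) + (i, j)" "\<bar>i - 0\<bar> + \<bar>j - 0\<bar> \<le> 1"
      by (rule cross_offset)
    have u2: "u + (1, 2) = (x, y) + (i + 1, j + 2)" unfolding ij by simp
    show ?thesis
      unfolding u2 unfolding ij(1) using eq[of i j] eq[of "i + 1" "j + 2"] ij(2) by linarith
  qed
  then show ?thesis unfolding right_handed_def by blast
qed

text \<open>Below this bound all sets of the sequence have so few unclean vertices that
  right-handedness would be carried from \<open>D\<close> to \<open>D'\<close>.\<close>

lemma transforms_handed_lower_bound:
  assumes T: "transforms verts edges k D D'"
    and D: "\<And>y. good_row D y" "\<And>v. right_handed (enc -` D) v"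
    and D': "\<And>y. good_row D' y" "\<And>v. \<not> right_handed (enc -` D') v"
  shows "nat m + 110 * (card verts div 5) \<le> 110 * k"
proof (rule ccontr)
  assume less: "\<not> ?thesis"
  obtain l :: nat and S where S: "S 0 = D" "S l = D'"
      "\<forall>i\<in>{0..l}. dominating verts edges (S i) \<and> card (S i) \<le> k"
      "\<forall>i\<in>{1..l}. adjacent_sets (S (i - 1)) (S i)"
    using T unfolding transforms_def by metis
  \<comment> \<open>The factor 22 is \<open>2 * 11\<close>: 11 rows spoiled per unclean vertex, for
    two consecutive sets at once. The factor 5 of \<open>card_unclean\<close> turns it into
    110.\<close>
  have few: "22 * card (unclean (S i)) < nat m" if "i \<le> l" for i
  proof -
    have "card (unclean (S i)) + card verts \<le> 5 * k"
      using card_unclean[of "S i"] S(3) that by force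
    then show ?thesis using less by linarith
  qed
  \<comment> \<open>The invariant speaks of good rows only, since handedness is not controlled
    elsewhere. It passes to the next set along a row good for both, then to all good rows of that
    set.\<close>
  have "\<forall>y x. good_row (S i) y \<longrightarrow> right_handed (enc -` S i) (x, y)" if "i \<le> l" for i
    using that
  proof (induction i)
    case 0
    then show ?case using D S(1) by simp
  next
    case (Suc i)
    have fin: "finite (S j)" if "j \<le> l" for j
    proof -
      have "dominating verts edges (S j)" using S(3) that by simp
      then show ?thesis using finite_verts finite_subset unfolding dominating_def by blast
    qed
    have "11 * card (unclean (S i)) + 11 * card (unclean (S (Suc i))) < nat m"
      using few[of i] few[of "Suc i"] Suc.prems by linarith
    then obtain y where y: "good_row (S i) y" "good_row (S (Suc i)) y"
      using exists_common_good_row by blast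
    have "adjacent_sets (S i) (S (Suc i))"
      using S(4)[rule_format, of "Suc i"] Suc.prems by simp
    then have "S i \<subseteq> S (Suc i) \<or> S (Suc i) \<subseteq> S i"
      using fin Suc.prems by (intro adjacent_sets_subset) auto
    moreover have "right_handed (enc -` S i) (0, y)"
      using Suc y by simp
    ultimately have "right_handed (enc -` S (Suc i)) (0, y)"
      using right_handed_subset y by blast
    moreover have "11 * card (unclean (S (Suc i))) < nat m"
      using few[OF Suc.prems] by linarith
    ultimately show ?case
      using right_handed_rows y by blast
  qed
  from this[of l] show False using D' S(2) by auto
qed

end

section \<open>The two mirror-image perfect codes\<close>

definition code :: "int \<Rightarrow> (int \<times> int) set" where
  "code a = {v. 5 dvd fst v + a * snd v}"

text \<open>On a cross the linear form takes the values \<open>c\<close>, \<open>c + 1\<close>,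
  \<open>c - 1\<close>, \<open>c + a\<close> and \<open>c - a\<close>. For \<open>a\<close> equal to
  2 or -2 these meet each residue modulo 5 once.\<close>

lemma clean_code:
  assumes "a \<in> {2, -2}"
  shows "clean (code a) v"
proof -
  define c where "c = fst v + a * snd v"
  have residue: "c mod 5 \<in> {0, 1, 2, 3, 4}" by auto
  have dvd: "5 dvd c \<longleftrightarrow> c mod 5 = 0" "5 dvd c + 1 \<longleftrightarrow> c mod 5 = 4" "5 dvd c - 1 \<longleftrightarrow> c mod 5 = 1"
    "5 dvd c + 2 \<longleftrightarrow> c mod 5 = 3" "5 dvd c - 2 \<longleftrightarrow> c mod 5 = 2"
    by presburger+
  have "card (cross v \<inter> code a) = (\<Sum>u\<in>cross v. of_bool (u \<in> code a))"
    by (simp add: cross_def Int_def)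
  also have "\<dots> = of_bool (5 dvd c) + of_bool (5 dvd c + 1) +
      of_bool (5 dvd c - 1) + of_bool (5 dvd c + a) + of_bool (5 dvd c - a)"
    unfolding cross_def c_def by (cases v) (simp add: code_def algebra_simps)
  also have "\<dots> = 1"
    using assms residue by (elim insertE emptyE; hypsubst; simp add: dvd del: dvd_eq_mod_eq_0)
  finally show ?thesis unfolding clean_def .
qed

context torus_grid
begin

definition code_set :: "int \<Rightarrow> nat set" where
  "code_set a = enc ` code a"

context
  assumes five_dvd: "5 dvd m"
begin

text \<open>As 5 divides \<open>m\<close>, the code has period \<open>m\<close> in both coordinates,
  so wrapping it around the torus and pulling it back adds no points.\<close>

lemma vimage_code_set: "enc -` code_set a = code a"
proof
  show "enc -` code_set a \<subseteq> code a"
  proof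
    fix v assume "v \<in> enc -` code_set a"
    then obtain w where w: "5 dvd fst w + a * snd w" "fst v mod m = fst w mod m" "snd v mod m = snd w mod m"
      unfolding code_set_def code_def by (auto simp: enc_eq_iff)
    then have "fst v mod 5 = fst w mod 5" "snd v mod 5 = snd w mod 5"
      using five_dvd mod_mod_cancel by metis+
    then have "(fst v + a * snd v) mod 5 = (fst w + a * snd w) mod 5"
      by (intro mod_add_cong mod_mult_cong) auto
    with w show "v \<in> code a" unfolding code_def by (simp add: dvd_eq_mod_eq_0)
  qed
qed (auto simp: code_set_def)

lemma good_row_code_set: "a \<in> {2, -2} \<Longrightarrow> good_row (code_set a) y"
  unfolding good_row_def clean_box_def vimage_code_set using clean_code by blast

lemma closed_neighborhood_code_set:
  assumes "a \<in> {2, -2}" "u \<in> verts"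
  shows "card (insert u (neighbors edges u) \<inter> code_set a) = 1"
  using assms clean_enc[of "code_set a"] clean_code unfolding vimage_code_set verts_def by blast

lemma dominating_code_set:
  assumes "a \<in> {2, -2}"
  shows "dominating verts edges (code_set a)"
  unfolding dominating_def
proof (intro conjI ballI)
  show "code_set a \<subseteq> verts" unfolding code_set_def verts_def by blast
  fix u assume "u \<in> verts"
  then have "insert u (neighbors edges u) \<inter> code_set a \<noteq> {}"
    using closed_neighborhood_code_set[OF assms] by fastforce
  then show "u \<in> code_set a \<or> neighbors edges u \<inter> code_set a \<noteq> {}" by blast
qed

text \<open>All terms of \<open>sum_closed_neighborhoods\<close> are 1 for a perfect code.\<close>

lemma card_code_set:
  assumes "a \<in> {2, -2}"
  shows "5 * card (code_set a) = card verts"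
proof -
  have "code_set a \<subseteq> verts" unfolding code_set_def verts_def by blast
  from sum_closed_neighborhoods[OF finite_simple regular4 this]
  show ?thesis using closed_neighborhood_code_set[OF assms] by simp
qed

lemma right_handed_code_set: "right_handed (enc -` code_set 2) v"
proof -
  obtain u where u: "u \<in> cross v" "u \<in> code 2"
    using clean_obtain[OF clean_code[of 2 v]] by auto
  \<comment> \<open>The move \<open>(1, 2)\<close> raises the form \<open>x + 2 y\<close> by exactly
    5.\<close>
  then have "5 dvd (fst u + 2 * snd u) + 5" unfolding code_def by (simp only: mem_Collect_eq) presburger
  then have "u + (1, 2) \<in> code 2" unfolding code_def by (simp add: algebra_simps)
  with u show ?thesis unfolding right_handed_def vimage_code_set by blast
qed

lemma not_right_handed_code_set: "\<not> right_handed (enc -` code_set (-2)) v"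
proof -
  \<comment> \<open>The same move changes \<open>x - 2 y\<close> by -3, which leaves the multiples
    of 5.\<close>
  have "u + (1, 2) \<notin> code (-2)" if "u \<in> code (-2)" for u
    using that unfolding code_def mem_Collect_eq fst_add snd_add fst_conv snd_conv by presburger
  then show ?thesis unfolding right_handed_def vimage_code_set by blast
qed

lemma partial_gamma_code_sets:
  "real_of_int (partial_gamma verts edges (code_set 2) (code_set (-2))) \<ge> 1 / 110 * sqrt (real (card verts))"
proof -
  define k where "k = (LEAST k. 0 < k \<and> transforms verts edges k (code_set 2) (code_set (-2)))"
  have "0 < card verts" using m_ge by (simp add: card_verts)
  moreover have "transforms verts edges (card verts) (code_set 2) (code_set (-2))"
    by (intro transforms_card finite_verts dominating_code_set) auto
  ultimately have "transforms verts edges k (code_set 2) (code_set (-2))"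
    unfolding k_def using LeastI_ex[of "\<lambda>k. 0 < k \<and> transforms verts edges k (code_set 2) (code_set (-2))"]
    by blast
  then have *: "nat m + 110 * (card verts div 5) \<le> 110 * k"
    by (rule transforms_handed_lower_bound)
      (auto simp: good_row_code_set right_handed_code_set not_right_handed_code_set)
  have card: "card (code_set 2) = card verts div 5" "card (code_set (-2)) = card verts div 5"
    using card_code_set[of 2] card_code_set[of "-2"] by auto
  have "partial_gamma verts edges (code_set 2) (code_set (-2)) = int k - int (card verts div 5)"
    unfolding partial_gamma_def k_def card by simp
  moreover have "sqrt (real (card verts)) = real (nat m)"
    by (simp add: card_verts)
  moreover have "real (nat m) + 110 * real (card verts div 5) \<le> 110 * real k"
    using * by linarith
  ultimately show ?thesis by simp
qed

end

end

section \<open>Embedding in the torus\<close>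

context torus_grid
begin

text \<open>The universal covering of the torus by the plane, scaled to period \<open>m\<close> in
  each coordinate: integer points become vertices and unit grid segments become edges.\<close>

definition torus_point :: "real \<Rightarrow> real \<Rightarrow> complex \<times> complex" where
  "torus_point a b = (cis (2 * pi * a / m), cis (2 * pi * b / m))"

lemma cis_scaled_eq_iff:
  "cis (2 * pi * a / m) = cis (2 * pi * b / m) \<longleftrightarrow> (\<exists>i::int. a = b + m * i)"
proof -
  have "cis (2 * pi * a / m) = cis (2 * pi * b / m) \<longleftrightarrow>
      (\<exists>i::int. 2 * pi * a / m = 2 * pi * b / m + 2 * pi * i)"
    unfolding complex_eq_iff cis.simps by (subst conj_commute) (rule sin_cos_eq_iff)
  also have "\<dots> \<longleftrightarrow> (\<exists>i::int. a = b + m * i)"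
  proof (intro ex_cong1)
    fix i
    have "2 * pi * b / m + 2 * pi * i = 2 * pi * (b + m * i) / m"
      using m_ge by (simp add: field_simps)
    then show "2 * pi * a / m = 2 * pi * b / m + 2 * pi * i \<longleftrightarrow> a = b + m * i"
      using m_ge by simp
  qed
  finally show ?thesis .
qed

lemma torus_point_eq_iff:
  "torus_point a b = torus_point a' b' \<longleftrightarrow> (\<exists>i::int. a = a' + m * i) \<and> (\<exists>j::int. b = b' + m * j)"
  unfolding torus_point_def by (simp only: prod.inject cis_scaled_eq_iff)

lemma torus_point_int_eq_iff:
  "torus_point (of_int a) (of_int b) = torus_point (of_int a') (of_int b') \<longleftrightarrow> a mod m = a' mod m \<and> b mod m = b' mod m"
proof -
  have "(\<exists>i::int. real_of_int x = y + m * i) \<longleftrightarrow> x mod m = y mod m" for x y :: int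
  proof -
    have "(\<exists>i::int. real_of_int x = y + m * i) \<longleftrightarrow> (\<exists>i. x = y + m * i)"
      by (metis (mono_tags, lifting) of_int_add of_int_eq_iff of_int_mult)
    also have "\<dots> \<longleftrightarrow> x mod m = y mod m"
      by (auto simp: mod_eq_dvd_iff dvd_def algebra_simps)
    finally show ?thesis .
  qed
  then show ?thesis unfolding torus_point_eq_iff by simp
qed

definition vertex_point :: "nat \<Rightarrow> complex \<times> complex" where
  "vertex_point u = torus_point (of_int (int u div m)) (of_int (int u mod m))"

lemma vertex_point_enc: "vertex_point (enc v) = torus_point (of_int (fst v)) (of_int (snd v))"
  unfolding vertex_point_def enc_div enc_mod torus_point_int_eq_iff by simp

lemma inj_on_vertex_point: "inj_on vertex_point verts"
  unfolding inj_on_def verts_def by (auto simp: vertex_point_enc torus_point_int_eq_iff enc_eq_iff)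

definition edge_path :: "int \<times> int \<Rightarrow> int \<times> int \<Rightarrow> real \<Rightarrow> complex \<times> complex" where
  "edge_path v d t = torus_point (of_int (fst v) + t * of_int (fst d)) (of_int (snd v) + t * of_int (snd d))"

text \<open>Vertices lift to integer points and the periods are integers, so the coordinate that
  moves along the edge must be an integer there, and with it \<open>t\<close>.\<close>

lemma vertex_point_on_edge_path:
  assumes d: "d \<in> {(1, 0), (0, 1)}" and t: "0 \<le> t" "t \<le> 1"
    and u: "edge_path v d t \<in> vertex_point ` verts"
  shows "t = 0 \<or> t = 1"
proof -
  obtain w where "edge_path v d t = torus_point (of_int (fst w)) (of_int (snd w))"
    using u unfolding verts_def by (auto simp: vertex_point_enc)
  then obtain i j :: int where "fst v + t * fst d = fst w + m * i" "snd v + t * snd d = snd w + m * j"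
    unfolding edge_path_def torus_point_eq_iff by auto
  then have "t = of_int (fst w + m * i - fst v) \<or> t = of_int (snd w + m * j - snd v)"
    using d by auto
  then obtain n :: int where "t = of_int n" by blast
  then show ?thesis using t by auto
qed

lemma edge_path_ends: "edge_path v d 0 = vertex_point (enc v)" "edge_path v d 1 = vertex_point (enc (v + d))"
  unfolding edge_path_def vertex_point_enc by simp_all

text \<open>Lifted to the plane, the two points differ by a period. Parallel segments then have
  parameters differing by an integer of absolute value below 1, hence equal ones, and their base
  points agree modulo \<open>m\<close>.\<close>

lemma edge_path_eq:
  assumes d: "d \<in> {(1, 0), (0, 1)}" "d' \<in> {(1, 0), (0, 1)}"
    and t: "0 < t" "t < 1" "0 < t'" "t' < 1" and eq: "edge_path v d t = edge_path v' d' t'"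
  shows "{enc v, enc (v + d)} = {enc v', enc (v' + d')} \<and> t = t'"
proof -
  obtain i j :: int where ij: "fst v + t * fst d = fst v' + t' * fst d' + m * i"
      "snd v + t * snd d = snd v' + t' * snd d' + m * j"
    using eq unfolding edge_path_def torus_point_eq_iff by auto
  have not_int: "t \<noteq> of_int n" "t' \<noteq> of_int n" for n
    using t by auto
  have dd: "d' = d"
  proof (rule ccontr)
    assume "d' \<noteq> d"
    \<comment> \<open>For different directions some coordinate moves along the first path and rests
      on the second, which would make \<open>t\<close> an integer.\<close>
    then have "t = of_int (fst v' + m * i - fst v) \<or> t = of_int (snd v' + m * j - snd v)"
      using d ij by auto
    then show False using not_int by blast
  qed
  have "t - t' = of_int (fst v' + m * i - fst v) \<or> t - t' = of_int (snd v' + m * j - snd v)"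
    using d ij unfolding dd by auto
  then obtain n :: int where n: "t - t' = of_int n" by blast
  then have "\<bar>real_of_int n\<bar> < 1" using t by linarith
  then have "n = 0" by linarith
  then have tt: "t = t'" using n by simp
  have "real_of_int (fst v) = of_int (fst v' + m * i)" "real_of_int (snd v) = of_int (snd v' + m * j)"
    using ij unfolding dd tt by auto
  then have "fst v = fst v' + m * i" "snd v = snd v' + m * j"
    by (simp_all only: of_int_eq_iff)
  then have "enc v = enc v'" unfolding enc_eq_iff by simp
  then show ?thesis using enc_add_cong[of v v' d] dd tt by simp
qed

lemma continuous_edge_path: "continuous_on A (edge_path v d)"
  unfolding edge_path_def torus_point_def
  by (intro continuous_on_Pair continuous_on_cis continuous_on_divide continuous_on_mult continuous_on_add
      continuous_on_const continuous_on_id ballI) (use m_ge in simp_all)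

text \<open>For injectivity, the parameters 0 and 1 give two distinct vertices, interior parameters
  never give vertices, and \<open>edge_path_eq\<close> compares the interior of the path with
  itself.\<close>

lemma arc_edge_path:
  assumes d: "d \<in> {(1, 0), (0, 1)}"
  shows "arc (edge_path v d)"
  unfolding arc_def path_def
proof (intro conjI continuous_edge_path inj_onI)
  fix s t :: real
  assume st: "s \<in> {0..1}" "t \<in> {0..1}" and eq: "edge_path v d s = edge_path v d t"
  have ends: "vertex_point (enc v) \<noteq> vertex_point (enc (v + d))"
    using inj_on_vertex_point edge_ends_distinct[OF d] unfolding inj_on_def verts_def by blast
  have mem: "edge_path v d r \<in> vertex_point ` verts" if "r = 0 \<or> r = 1" for r
    using that unfolding verts_def by (auto simp: edge_path_ends)
  show "s = t"
  proof (cases "edge_path v d s \<in> vertex_point ` verts")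
    case True
    then have "s = 0 \<or> s = 1" "t = 0 \<or> t = 1"
      using vertex_point_on_edge_path[OF d, of s v] vertex_point_on_edge_path[OF d, of t v] st eq
      by simp_all
    then show ?thesis using eq ends edge_path_ends by metis
  next
    case False
    then have "s \<noteq> 0" "s \<noteq> 1" "t \<noteq> 0" "t \<noteq> 1" using mem eq by metis+
    then show ?thesis using edge_path_eq[OF d d _ _ _ _ eq] st by auto
  qed
qed

lemma path_image_edge_path_vertices:
  assumes d: "d \<in> {(1, 0), (0, 1)}"
  shows "path_image (edge_path v d) \<inter> vertex_point ` verts = vertex_point ` {enc v, enc (v + d)}"
proof
  show "path_image (edge_path v d) \<inter> vertex_point ` verts \<subseteq> vertex_point ` {enc v, enc (v + d)}"
  proof
    fix z assume z: "z \<in> path_image (edge_path v d) \<inter> vertex_point ` verts"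
    then obtain t where t: "z = edge_path v d t" "t \<in> {0..1}"
      unfolding path_image_def by blast
    then have "t = 0 \<or> t = 1"
      using vertex_point_on_edge_path[OF d, of t v] z by simp
    then show "z \<in> vertex_point ` {enc v, enc (v + d)}"
      using t(1) by (auto simp: edge_path_ends)
  qed
  have "edge_path v d 0 \<in> path_image (edge_path v d)" "edge_path v d 1 \<in> path_image (edge_path v d)"
    unfolding path_image_def by auto
  then show "vertex_point ` {enc v, enc (v + d)} \<subseteq> path_image (edge_path v d) \<inter> vertex_point ` verts"
    unfolding edge_path_ends verts_def by blast
qed

lemma path_images_meet_in_vertices:
  assumes d: "d \<in> {(1, 0), (0, 1)}" "d' \<in> {(1, 0), (0, 1)}"
    and z: "z \<in> path_image (edge_path v d)" "z \<in> path_image (edge_path v' d')"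
    and neq: "{enc v, enc (v + d)} \<noteq> {enc v', enc (v' + d')}"
  shows "z \<in> vertex_point ` verts"
proof (rule ccontr)
  assume nz: "z \<notin> vertex_point ` verts"
  obtain t t' where t: "z = edge_path v d t" "t \<in> {0..1}" "z = edge_path v' d' t'" "t' \<in> {0..1}"
    using z unfolding path_image_def by blast
  have mem: "edge_path v d r \<in> vertex_point ` verts" if "r = 0 \<or> r = 1" for r v d
    using that unfolding verts_def by (auto simp: edge_path_ends)
  have "t \<noteq> 0" "t \<noteq> 1" "t' \<noteq> 0" "t' \<noteq> 1" using mem nz t by metis+
  then show False using edge_path_eq[OF d, of t t' v v'] t neq by simp
qed

lemma torus_point_in_torus: "torus_point a b \<in> torus"
  unfolding torus_point_def torus_def by simp

lemma embeddable_torus: "embeddable_in torus verts edges"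
proof -
  have "\<forall>e\<in>edges. \<exists>v d. e = {enc v, enc (v + d)} \<and> d \<in> {(1, 0), (0, 1)}"
    unfolding edges_def by blast
  \<comment> \<open>An edge is an unordered pair; choosing a base point and a direction fixes the
    path that represents it.\<close>
  then obtain f g where fg: "\<And>e. e \<in> edges \<Longrightarrow> e = {enc (f e), enc (f e + g e)}"
      "\<And>e. e \<in> edges \<Longrightarrow> g e \<in> {(1, 0), (0, 1)}"
    by metis
  define \<gamma> where "\<gamma> e = edge_path (f e) (g e)" for e
  have meet: "path_image (\<gamma> e) \<inter> vertex_point ` verts = vertex_point ` e" if "e \<in> edges" for e
    using path_image_edge_path_vertices[OF fg(2)[OF that], of "f e"] fg(1)[OF that] unfolding \<gamma>_def by simp
  show ?thesis
    unfolding embeddable_in_def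
  proof (intro exI[of _ vertex_point] exI[of _ \<gamma>] conjI ballI impI inj_on_vertex_point)
    show "vertex_point ` verts \<subseteq> torus"
      unfolding vertex_point_def using torus_point_in_torus by blast
    fix e assume e: "e \<in> edges"
    show "arc (\<gamma> e)" unfolding \<gamma>_def by (rule arc_edge_path[OF fg(2)[OF e]])
    show "path_image (\<gamma> e) \<subseteq> torus"
      unfolding \<gamma>_def path_image_def edge_path_def using torus_point_in_torus by blast
    have "{pathstart (\<gamma> e), pathfinish (\<gamma> e)} = vertex_point ` {enc (f e), enc (f e + g e)}"
      unfolding \<gamma>_def pathstart_def pathfinish_def edge_path_ends by simp
    then show "{pathstart (\<gamma> e), pathfinish (\<gamma> e)} = vertex_point ` e"
      unfolding fg(1)[OF e, symmetric] .
    show "path_image (\<gamma> e) \<inter> vertex_point ` verts = vertex_point ` e" by (rule meet[OF e])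
    fix e' assume e': "e' \<in> edges" and neq: "e \<noteq> e'"
    have "path_image (\<gamma> e) \<inter> path_image (\<gamma> e') \<subseteq> vertex_point ` verts"
    proof
      fix z assume "z \<in> path_image (\<gamma> e) \<inter> path_image (\<gamma> e')"
      then show "z \<in> vertex_point ` verts"
        unfolding \<gamma>_def using fg(1)[OF e] fg(1)[OF e'] neq
        by (intro path_images_meet_in_vertices[OF fg(2)[OF e] fg(2)[OF e']]) auto
    qed
    \<comment> \<open>All common points are vertices, and each arc meets the vertices only in its
      own ends.\<close>
    then have "path_image (\<gamma> e) \<inter> path_image (\<gamma> e') = vertex_point ` e \<inter> vertex_point ` e'"
      using meet[OF e] meet[OF e'] by blast
    also have "\<dots> = vertex_point ` (e \<inter> e')"
      using finite_simple e e' unfolding finite_simple_graph_def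
      by (intro inj_on_image_Int[OF inj_on_vertex_point, symmetric]) auto
    finally show "path_image (\<gamma> e) \<inter> path_image (\<gamma> e') = vertex_point ` (e \<inter> e')" .
  qed
qed

end

theorem theorem1:
  "\<exists>c::real. c > 0 \<and>
     (\<forall>n::nat. n > 0 \<longrightarrow>
       (\<exists>(V :: nat set) (E :: nat set set) (D :: nat set) (D' :: nat set).
          finite_simple_graph V E \<and> regular 4 V E \<and> card V \<ge> n \<and>
          embeddable_in torus V E \<and>
          dominating V E D \<and> dominating V E D' \<and>
          real (card D) = real (card V) / 5 \<and> real (card D') = real (card V) / 5 \<and>
          real_of_int (partial_gamma V E D D') \<ge> c * sqrt (real (card V))))"
proof (intro exI[of _ "1 / 110"] conjI allI impI)
  fix n :: nat assume n: "n > 0"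
  \<comment> \<open>The side \<open>5 * n\<close> is a multiple of 5, as the codes require, and
    gives \<open>25 * n^2\<close> vertices, at least \<open>n\<close>.\<close>
  interpret torus_grid "int (5 * n)"
    using n by unfold_locales simp
  have dvd: "5 dvd int (5 * n)" by simp
  have "n \<le> card verts"
    unfolding card_verts nat_int using n by simp
  moreover have "real (card (code_set a)) = real (card verts) / 5" if "a \<in> {2, -2}" for a
    using card_code_set[OF dvd that] by linarith
  ultimately show "\<exists>(V :: nat set) (E :: nat set set) (D :: nat set) (D' :: nat set).
          finite_simple_graph V E \<and> regular 4 V E \<and> card V \<ge> n \<and>
          embeddable_in torus V E \<and>
          dominating V E D \<and> dominating V E D' \<and>
          real (card D) = real (card V) / 5 \<and> real (card D') = real (card V) / 5 \<and>
          real_of_int (partial_gamma V E D D') \<ge> 1 / 110 * sqrt (real (card V))"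
    using finite_simple regular4 embeddable_torus dominating_code_set[OF dvd] partial_gamma_code_sets[OF dvd]
    by (intro exI[of _ verts] exI[of _ edges] exI[of _ "code_set 2"] exI[of _ "code_set (-2)"]) simp
qed simp

end
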